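(* Let $m\in\mathbb{N}$ and let $V\in H_{+}^{-m}$ be a 1-periodic complex-valued distribution. Then the operators $S_{+}(V)$ and $S_{-}(V)$ on $L_2(0,1)$ are local: if $u\in\mathrm{Dom}(S_{\pm})$ and $u|_{(a,b)}=0$ for an interval $(a,b)\subset[0,1]$, then $(S_{\pm}(V)u)|_{(a,b)}=0$.
   Context: For $s\in\mathbb{R}$, $H_{+}^{s}$ is the space of formal series $f=\sum_{k\in\mathbb{Z}}\widehat f(2k)e^{i2k\pi x}$ with $\|f\|_{H_+^s}^2=\sum_k\langle 2k\rangle^{2s}|\widehat f(2k)|^2<\infty$, and $H_{-}^{s}$ is the space of formal series $f=\sum_{k}\widehat f(2k+1)e^{i(2k+1)\pi x}$ with $\|f\|_{H_-^s}^2=\sum_k\langle 2k+1\rangle^{2s}|\widehat f(2k+1)|^2<\infty$, where $\langle k\rangle=1+|k|$; $H_\pm^0=L_2(0,1)$. $\langle\cdot,\cdot\rangle_{\pm}$ is the pairing between $H_\pm^{s}$ and $H_\pm^{-s}$ extending the $L_2(0,1)$ inner product. $D_{\pm}=-i\,d/dx$ on $H_\pm^1$, $D_\pm^{2m}=|D_\pm|^{2m}$ (multiplication by $(n\pi)^{2m}$ on the mode $e^{in\pi x}$). For $u\in H_\pm^{m}$, $V(x)u=\sum_n\big(\sum_j\widehat V(n-j)\widehat u(j)\big)e^{in\pi x}\in H_\pm^{-m}$. $S_{\pm}(V)=D_{\pm}^{2m}\dotplus V$ is the $m$-sectorial operator on $L_2(0,1)$ associated with the closed sectorial form $t_\pm[u,v]=\langle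 D_{\pm}^{2m}u,v\rangle_{\pm}+\langle V(x)u,v\rangle_{\pm}$, $\mathrm{Dom}(t_\pm)=H_\pm^m$; explicitly $\mathrm{Dom}(S_{\pm})=\{u\in H_{\pm}^{m}\mid D_{\pm}^{2m}u+V(x)u\in L_{2}(0,1)\}$ and $S_\pm(V)u=D_{\pm}^{2m}u+V(x)u$. *)

theory Defs
  imports "HOL-Analysis.Analysis"
begin

text \<open>Parity selector: p = True stands for the sign +, i.e. the even modes
  e^{i 2k pi x} (spaces H_+^s); p = False stands for the sign -, i.e. the odd
  modes e^{i (2k+1) pi x} (spaces H_-^s).  Elements of H_p^s are represented by
  their Fourier coefficient sequences int => complex (supported on the
  integers of parity p).\<close>

definition japan :: "int \<Rightarrow> real" where
  "japan k = 1 + real_of_int \<bar>k\<bar>"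

definition in_H :: "bool \<Rightarrow> real \<Rightarrow> (int \<Rightarrow> complex) \<Rightarrow> bool" where
  "in_H p s c \<longleftrightarrow> (\<forall>n. c n \<noteq> 0 \<longrightarrow> even n = p) \<and>
     (\<lambda>n. japan n powr (2 * s) * (norm (c n))\<^sup>2) summable_on UNIV"

definition L2_01 :: "(real \<Rightarrow> complex) \<Rightarrow> bool" where
  "L2_01 f \<longleftrightarrow> f \<in> borel_measurable lborel \<and>
     set_integrable lborel {0..1} (\<lambda>x. (norm (f x))\<^sup>2)"

definition fcoef :: "(real \<Rightarrow> complex) \<Rightarrow> int \<Rightarrow> complex" where
  "fcoef f n = (LINT x:{0..1}|lborel. f x * cis (- (real_of_int n * pi * x)))"

text \<open>Coefficient sequence of u in L_2(0,1) = H_p^0 (expansion in the modes of parity p).\<close>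
definition coef :: "bool \<Rightarrow> (real \<Rightarrow> complex) \<Rightarrow> int \<Rightarrow> complex" where
  "coef p u n = (if even n = p then fcoef u n else 0)"

definition mult_V :: "(int \<Rightarrow> complex) \<Rightarrow> (int \<Rightarrow> complex) \<Rightarrow> int \<Rightarrow> complex" where
  "mult_V V c n = infsum (\<lambda>j. V (n - j) * c j) UNIV"

text \<open>Coefficients of D_p^{2m} u + V u (an element of H_p^{-m}).\<close>
definition S_coef :: "bool \<Rightarrow> nat \<Rightarrow> (int \<Rightarrow> complex) \<Rightarrow> (real \<Rightarrow> complex) \<Rightarrow> int \<Rightarrow> complex" where
  "S_coef p m V u n =
     (if even n = p then complex_of_real ((real_of_int n * pi) ^ (2 * m)) * coef p u n
        + mult_V V (coef p u) n else 0)"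

definition S_repr :: "bool \<Rightarrow> nat \<Rightarrow> (int \<Rightarrow> complex) \<Rightarrow> (real \<Rightarrow> complex) \<Rightarrow> (real \<Rightarrow> complex) \<Rightarrow> bool" where
  "S_repr p m V u g \<longleftrightarrow> L2_01 g \<and> (\<forall>n. even n = p \<longrightarrow> fcoef g n = S_coef p m V u n)"

definition S_dom :: "bool \<Rightarrow> nat \<Rightarrow> (int \<Rightarrow> complex) \<Rightarrow> (real \<Rightarrow> complex) \<Rightarrow> bool" where
  "S_dom p m V u \<longleftrightarrow> L2_01 u \<and> in_H p (real m) (coef p u) \<and> (\<exists>g. S_repr p m V u g)"

end

theory Submission
  imports Defs
begin

text \<open>
  Pair \<open>g\<close> with a test function \<open>\<phi>\<close> supported in \<open>(a, b)\<close>. By Parseval the pairing is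
  \<open>\<Sum>n. \<psi> n * (S_coef n)\<close> with \<open>\<psi> n = fcoef \<phi> (- n)\<close>. The differential part equals, up to sign,
  \<open>\<integral> u * \<phi>\<^bsup>(2m)\<^esup>\<close>, and in the potential part the double series
  \<open>\<Sum>n j. \<psi> n * V (n - j) * c j\<close> converges absolutely, so it can be summed as
  \<open>\<Sum>k. V k * \<integral> u(x) * e\<^bsup>i k pi x\<^esup> * \<phi>(x)\<close>. All these integrals vanish because \<open>u = 0\<close> on the support
  of \<open>\<phi>\<close>. Test functions of class \<open>C\<^bsup>2m+2\<^esup>\<close> suffice, and letting them approach indicators of
  intervals gives \<open>g = 0\<close> almost everywhere on \<open>(a, b)\<close>.
\<close>

section \<open>Test functions\<close>

text \<open>A test function is carried together with its first \<open>N\<close> derivatives, so that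
  a differentiated test function is simply a shifted sequence. Continuity of the last member makes
  integration by parts available at every order.\<close>

definition test_chain :: "nat \<Rightarrow> real \<Rightarrow> real \<Rightarrow> (nat \<Rightarrow> real \<Rightarrow> real) \<Rightarrow> bool" where
  "test_chain N \<alpha> \<beta> D \<longleftrightarrow>
     (\<forall>i<N. \<forall>x. (D i has_real_derivative D (Suc i) x) (at x)) \<and>
     (\<forall>i\<le>N. continuous_on UNIV (D i)) \<and>
     (\<forall>i\<le>N. \<forall>x. x \<le> \<alpha> \<or> \<beta> \<le> x \<longrightarrow> D i x = 0)"

lemma continuous_antiderivative:
  fixes f :: "real \<Rightarrow> real"
  assumes "continuous_on UNIV f"
  obtains F where "\<And>x. (F has_real_derivative f x) (at x)"
proof -
  have "\<exists>F. \<forall>x :: real. -\<infinity> < ereal x \<longrightarrow> ereal x < \<infinity> \<longrightarrow> (F has_vector_derivative f x) (at x)"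
    using assms by (intro einterval_antiderivative) (auto simp: continuous_on_eq_continuous_at)
  then show ?thesis
    using that by (auto simp: has_real_derivative_iff_has_vector_derivative)
qed

text \<open>Averaging over windows of length \<open>\<epsilon>\<close> gains one derivative; by the mean value theorem an average
  is a value taken inside the window, so support, bounds and plateau only shift by \<open>\<epsilon>\<close>.\<close>

lemma exists_test_chain:
  fixes c d \<epsilon> :: real
  assumes "\<epsilon> > 0"
  shows "\<exists>D. test_chain k (c - real k * \<epsilon>) d D \<and> (\<forall>x. 0 \<le> D 0 x \<and> D 0 x \<le> 1) \<and>
           (\<forall>x. c + \<epsilon> \<le> x \<and> x \<le> d - (real k + 1) * \<epsilon> \<longrightarrow> D 0 x = 1)"
proof (induction k)
  case 0
  \<comment> \<open>A trapezoid with flanks of slope \<open>1 / \<epsilon>\<close>. The outer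
    \<open>max 0\<close> keeps the support claim true even when \<open>d - c\<close> is too short
    for a plateau, or negative.\<close>
  define T where "T x = max 0 (min 1 (min ((x - c) / \<epsilon>) ((d - x) / \<epsilon>)))" for x
  have "continuous_on UNIV T"
    unfolding T_def using assms by (intro continuous_intros) auto
  moreover have "T x = 0" if "x \<le> c \<or> d \<le> x" for x
  proof -
    have "(x - c) / \<epsilon> \<le> 0 \<or> (d - x) / \<epsilon> \<le> 0"
      using that assms by (auto simp: divide_le_0_iff)
    then show ?thesis by (auto simp: T_def)
  qed
  moreover have "T x = 1" if "c + \<epsilon> \<le> x" "x \<le> d - \<epsilon>" for x
    using that assms by (auto simp: T_def field_simps)
  ultimately show ?case
    by (intro exI[of _ "\<lambda>_. T"]) (auto simp: test_chain_def T_def)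
next
  case (Suc k)
  then obtain D where D: "test_chain k (c - real k * \<epsilon>) d D" "\<And>x. 0 \<le> D 0 x \<and> D 0 x \<le> 1"
    "\<And>x. c + \<epsilon> \<le> x \<Longrightarrow> x \<le> d - (real k + 1) * \<epsilon> \<Longrightarrow> D 0 x = 1" by auto
  have cont: "continuous_on UNIV (D i)" if "i \<le> k" for i
    using D(1) that by (auto simp: test_chain_def)
  have der: "(D i has_real_derivative D (Suc i) x) (at x)" if "i < k" for i x
    using D(1) that by (auto simp: test_chain_def)
  have zero: "D i x = 0" if "i \<le> k" "x \<le> c - real k * \<epsilon> \<or> d \<le> x" for i x
    using D(1) that by (auto simp: test_chain_def)
  obtain F where F: "\<And>x. (F has_real_derivative D 0 x) (at x)"
    using continuous_antiderivative[OF cont[of 0]] by blast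
  \<comment> \<open>\<open>E 0\<close> is the average of \<open>D 0\<close> over the window from
    \<open>x\<close> to \<open>x + \<epsilon>\<close>, and its derivative is the difference quotient
    of \<open>D 0\<close> itself; hence the index shift in the \<open>Suc\<close> case. As the
    window lies to the right of \<open>x\<close>, the support grows only to the left and the plateau
    shrinks only on the right.\<close>
  define E where "E i x = (case i of 0 \<Rightarrow> (F (x + \<epsilon>) - F x) / \<epsilon> | Suc j \<Rightarrow> (D j (x + \<epsilon>) - D j x) / \<epsilon>)" for i x
  have mean: "\<exists>\<xi>. x < \<xi> \<and> \<xi> < x + \<epsilon> \<and> E 0 x = D 0 \<xi>" for x
  proof -
    obtain \<xi> where "x < \<xi>" "\<xi> < x + \<epsilon>" "F (x + \<epsilon>) - F x = (x + \<epsilon> - x) * D 0 \<xi>"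
      using MVT2[of x "x + \<epsilon>" F "D 0"] F assms by auto
    then show ?thesis using assms by (intro exI[of _ \<xi>]) (auto simp: E_def)
  qed
  have derE: "(E i has_real_derivative E (Suc i) x) (at x)" if "i < Suc k" for i x
  proof (cases i)
    case 0
    have "((\<lambda>x. F (x + \<epsilon>)) has_real_derivative D 0 (x + \<epsilon>)) (at x)"
      using F[of "x + \<epsilon>"] unfolding DERIV_shift .
    from DERIV_cdivide[OF DERIV_diff[OF this F[of x]], of \<epsilon>] show ?thesis
      using 0 by (simp add: E_def[abs_def])
  next
    case (Suc j)
    have "((\<lambda>x. D j (x + \<epsilon>)) has_real_derivative D (Suc j) (x + \<epsilon>)) (at x)"
      using der[of j "x + \<epsilon>"] that Suc unfolding DERIV_shift by simp
    from DERIV_cdivide[OF DERIV_diff[OF this der[of j x]], of \<epsilon>] show ?thesis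
      using Suc that by (simp add: E_def[abs_def])
  qed
  have "continuous_on UNIV (E i)" if "i \<le> Suc k" for i
  proof (cases i)
    case 0
    then show ?thesis using derE by (meson DERIV_continuous_on DERIV_subset subset_UNIV zero_less_Suc)
  next
    case (Suc j)
    then have "continuous_on UNIV (\<lambda>x. (D j (x + \<epsilon>) - D j x) / \<epsilon>)"
      using assms that
      by (intro continuous_intros continuous_on_compose2[OF cont[of j]]) auto
    then show ?thesis using Suc by (simp add: E_def[abs_def])
  qed
  moreover have "E i x = 0" if "i \<le> Suc k" "x \<le> c - real (Suc k) * \<epsilon> \<or> d \<le> x" for i x
  proof (cases i)
    case 0
    obtain \<xi> where "x < \<xi>" "\<xi> < x + \<epsilon>" "E 0 x = D 0 \<xi>" using mean by blast
    then show ?thesis using 0 zero[of 0 \<xi>] that(2) by (auto simp: algebra_simps)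
  next
    case (Suc j)
    then show ?thesis using zero[of j x] zero[of j "x + \<epsilon>"] that assms
      by (auto simp: E_def algebra_simps)
  qed
  moreover have "0 \<le> E 0 x \<and> E 0 x \<le> 1" for x
    using mean[of x] D(2) by auto
  moreover have "E 0 x = 1" if "c + \<epsilon> \<le> x" "x \<le> d - (real (Suc k) + 1) * \<epsilon>" for x
  proof -
    obtain \<xi> where "x < \<xi>" "\<xi> < x + \<epsilon>" "E 0 x = D 0 \<xi>" using mean by blast
    then show ?thesis using D(3)[of \<xi>] that by (auto simp: algebra_simps)
  qed
  ultimately show ?case
    using derE by (intro exI[of _ E]) (auto simp: test_chain_def)
qed

lemma test_chain_shift:
  assumes "test_chain (N + k) \<alpha> \<beta> D"
  shows "test_chain N \<alpha> \<beta> (\<lambda>i. D (k + i))"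
  using assms by (auto simp: test_chain_def add.commute)

section \<open>Decay of Fourier coefficients\<close>

lemma set_integrable_mult_bounded:
  fixes f h :: "'a \<Rightarrow> complex"
  assumes f: "set_integrable M A f" and h: "h \<in> borel_measurable M"
    and bound: "\<And>x. x \<in> A \<Longrightarrow> norm (h x) \<le> B"
  shows "set_integrable M A (\<lambda>x. f x * h x)"
proof -
  have "integrable M (\<lambda>x. of_real B * (indicator A x *\<^sub>R f x))"
    using f unfolding set_integrable_def by (rule integrable_mult_right)
  then have "integrable M (\<lambda>x. (indicator A x *\<^sub>R f x) * h x)"
  proof (rule Bochner_Integration.integrable_bound)
    show "(\<lambda>x. (indicator A x *\<^sub>R f x) * h x) \<in> borel_measurable M"
      using borel_measurable_integrable[OF f[unfolded set_integrable_def]] h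
      by (rule borel_measurable_times)
    show "AE x in M. norm ((indicator A x *\<^sub>R f x) * h x) \<le> norm (of_real B * (indicator A x *\<^sub>R f x))"
    proof (intro always_eventually allI)
      fix x show "norm ((indicator A x *\<^sub>R f x) * h x) \<le> norm (of_real B * (indicator A x *\<^sub>R f x))"
      proof (cases "x \<in> A")
        case True
        then have "norm (h x) \<le> \<bar>B\<bar>" using bound[OF True] by linarith
        then show ?thesis using True by (simp add: norm_mult mult.commute[of "\<bar>B\<bar>"] mult_left_mono)
      qed auto
    qed
  qed
  then show ?thesis by (simp add: set_integrable_def)
qed

lemma set_integrable_mult_cis:
  assumes "set_integrable lborel A f"
  shows "set_integrable lborel A (\<lambda>x. f x * cis (c * x))"
proof (rule set_integrable_mult_bounded[OF assms, of _ 1])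
  have "continuous_on UNIV (\<lambda>x. cis (c * x))" by (intro continuous_intros)
  then show "(\<lambda>x. cis (c * x)) \<in> borel_measurable lborel"
    by (simp add: borel_measurable_continuous_onI)
qed simp

text \<open>Integration by parts on the unit interval; the boundary terms vanish because
  \<open>0 \<le> \<alpha>\<close> and \<open>\<beta> \<le> 1\<close> force \<open>D i\<close> to be
  zero at both endpoints.\<close>

lemma fcoef_deriv:
  assumes D: "test_chain N \<alpha> \<beta> D" and "i < N" "0 \<le> \<alpha>" "\<beta> \<le> 1"
  shows "fcoef (\<lambda>x. complex_of_real (D (Suc i) x)) n
           = \<i> * of_int n * of_real pi * fcoef (\<lambda>x. complex_of_real (D i x)) n"
proof -
  define e where "e x = cis (- (real_of_int n * pi * x))" for x :: real
  define k where "k = - (\<i> * of_int n * of_real pi)"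
  have e': "(e has_vector_derivative k * e x) (at x within A)" for x A
  proof -
    have e: "e = (\<lambda>x. exp (k * of_real x))"
      by (auto simp: e_def k_def cis_conv_exp algebra_simps)
    show ?thesis unfolding e
      by (rule has_vector_derivative_real_field) (auto intro!: derivative_eq_intros)
  qed
  have D': "((\<lambda>x. complex_of_real (D i x)) has_vector_derivative complex_of_real (D (Suc i) x)) (at x within A)" for x A
    using D \<open>i < N\<close> unfolding test_chain_def
    by (intro has_vector_derivative_of_real) (auto intro: has_field_derivative_at_within)
  have c: "continuous_on A (D j)" if "j \<le> N" for j A
    using D that by (auto simp: test_chain_def intro: continuous_on_subset)
  have ce: "continuous_on A e" for A
    unfolding e_def by (intro continuous_intros)
  let ?f = "\<lambda>x. complex_of_real (D (Suc i) x) * e x"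
  let ?g = "\<lambda>x. complex_of_real (D i x) * e x"
  have cf: "continuous_on {0..1} ?f" and cg: "continuous_on {0..1} ?g"
    using \<open>i < N\<close> by (intro continuous_intros c ce; simp)+
  have "integral\<^sup>L lborel (\<lambda>x. indicator {0 .. 1} x *\<^sub>R (?f x + k * ?g x)) = ?g 1 - ?g 0"
  proof (rule integral_FTC_atLeastAtMost)
    show "(?g has_vector_derivative ?f x + k * ?g x) (at x within {0..1})" for x
      using has_vector_derivative_mult[OF D' e', of x "{0..1}"] by (simp add: algebra_simps)
    show "continuous_on {0..1} (\<lambda>x. ?f x + k * ?g x)"
      by (intro continuous_intros cf cg)
  qed auto
  also have "\<dots> = 0"
    using D assms(2-) by (auto simp: test_chain_def)
  finally have "(LINT x:{0..1}|lborel. ?f x + k * ?g x) = 0"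
    by (simp add: set_lebesgue_integral_def)
  moreover have "set_integrable lborel {0..1} ?f" "set_integrable lborel {0..1} ?g"
    by (intro borel_integrable_atLeastAtMost' cf cg)+
  ultimately have "(LINT x:{0..1}|lborel. ?f x) = - k * (LINT x:{0..1}|lborel. ?g x)"
    by (simp add: set_integral_add eq_neg_iff_add_eq_0)
  then show ?thesis by (simp add: fcoef_def e_def k_def)
qed

lemma fcoef_deriv_iterate:
  assumes D: "test_chain N \<alpha> \<beta> D" and "i \<le> N" "0 \<le> \<alpha>" "\<beta> \<le> 1"
  shows "fcoef (\<lambda>x. complex_of_real (D i x)) n
           = (\<i> * of_int n * of_real pi) ^ i * fcoef (\<lambda>x. complex_of_real (D 0 x)) n"
  using \<open>i \<le> N\<close>
proof (induction i)
  case (Suc i)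
  then show ?case using fcoef_deriv[OF D, of i n] assms by simp
qed auto

lemma norm_fcoef_le:
  assumes "set_integrable lborel {0..1} f"
  shows "norm (fcoef f n) \<le> (LINT x:{0..1}|lborel. norm (f x))"
  using set_integral_norm_bound[of lborel "{0..1}" "\<lambda>x. f x * cis (- (real_of_int n * pi * x))"]
  unfolding fcoef_def
proof (rule order_trans)
  show "set_integrable lborel {0..1} (\<lambda>x. f x * cis (- (real_of_int n * pi * x)))"
    using set_integrable_mult_cis[OF assms, of "- (real_of_int n * pi)"] by simp
qed (simp add: norm_mult)

lemma japan_pos: "japan n > 0" "japan n \<ge> 1"
  by (auto simp: japan_def)

text \<open>Integrating by parts \<open>N\<close> times trades the factor
  \<open>\<bar>n * pi\<bar> ^ N\<close> for the L1 norm \<open>M N\<close> of the last derivative;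
  the mode \<open>n = 0\<close>, where nothing is gained, is covered by \<open>M 0\<close>.\<close>

lemma fcoef_decay:
  assumes D: "test_chain N \<alpha> \<beta> D" and "0 \<le> \<alpha>" "\<beta> \<le> 1"
  obtains C where "C \<ge> 0" "\<And>n. norm (fcoef (\<lambda>x. complex_of_real (D 0 x)) n) * japan n ^ N \<le> C"
proof -
  define M where "M i = (LINT x:{0..1}|lborel. norm (complex_of_real (D i x)))" for i
  have M: "norm (fcoef (\<lambda>x. complex_of_real (D i x)) n) \<le> M i" if "i \<le> N" for i n
    unfolding M_def using D that
    by (intro norm_fcoef_le borel_integrable_atLeastAtMost' continuous_intros)
       (auto simp: test_chain_def intro: continuous_on_subset)
  have M0: "M i \<ge> 0" if "i \<le> N" for i using M[OF that, of 0] norm_ge_zero order_trans by blast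
  have "norm (fcoef (\<lambda>x. complex_of_real (D 0 x)) n) * japan n ^ N \<le> M 0 + M N" for n
  proof (cases "n = 0")
    case True
    then show ?thesis using M[of 0 0] M0[of N] by (simp add: japan_def)
  next
    case False
    \<comment> \<open>For a nonzero integer, \<open>1 + \<bar>n\<bar>\<close> is at most twice
      \<open>\<bar>n\<bar>\<close>, and \<open>pi > 3\<close> absorbs this factor, so the bound
      survives the \<open>N\<close>-th power without a constant.\<close>
    have "japan n \<le> pi * \<bar>real_of_int n\<bar>"
    proof -
      have "1 \<le> \<bar>real_of_int n\<bar>" using False by linarith
      then have "3 * \<bar>real_of_int n\<bar> \<le> pi * \<bar>real_of_int n\<bar>"
        using pi_gt3 by (intro mult_right_mono) auto
      then show ?thesis using \<open>1 \<le> \<bar>real_of_int n\<bar>\<close> by (simp add: japan_def)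
    qed
    then have "japan n ^ N \<le> (pi * \<bar>real_of_int n\<bar>) ^ N"
      using japan_pos[of n] by (intro power_mono) auto
    then have "norm (fcoef (\<lambda>x. complex_of_real (D 0 x)) n) * japan n ^ N
        \<le> norm (fcoef (\<lambda>x. complex_of_real (D 0 x)) n) * (pi * \<bar>real_of_int n\<bar>) ^ N"
      by (intro mult_left_mono) auto
    also have "\<dots> = norm (fcoef (\<lambda>x. complex_of_real (D N x)) n)"
      using fcoef_deriv_iterate[OF D order_refl assms(2,3), of n]
      by (simp add: norm_mult norm_power mult_ac)
    also have "\<dots> \<le> M 0 + M N" using M[of N n] M0[of 0] by simp
    finally show ?thesis .
  qed
  then show ?thesis using that[of "M 0 + M N"] M0 by simp
qed

lemma summable_inverse_japan_square: "(\<lambda>n. 1 / japan n ^ 2) summable_on UNIV"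
proof -
  have "summable (\<lambda>n. 1 / real (Suc n) ^ 2)"
    using inverse_power_summable[of 2, where ?'a = real] summable_Suc_iff[of "\<lambda>n. inverse (real n ^ 2)"]
    by (simp add: divide_inverse)
  then have s: "(\<lambda>n::nat. 1 / (1 + real n) ^ 2) summable_on UNIV"
    by (intro norm_summable_imp_summable_on) simp
  have "(\<lambda>n. 1 / japan n ^ 2) summable_on (range int)"
    using s by (subst summable_on_reindex) (auto simp: o_def japan_def)
  moreover have "(\<lambda>n. 1 / japan n ^ 2) summable_on (range (\<lambda>n. - int n))"
    using s by (subst summable_on_reindex) (auto simp: o_def japan_def inj_on_def)
  ultimately have "(\<lambda>n. 1 / japan n ^ 2) summable_on (range int \<union> range (\<lambda>n. - int n))"
    by (rule summable_on_union)
  moreover have "range int \<union> range (\<lambda>n. - int n) = UNIV"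
  proof -
    have "x \<in> range int \<union> range (\<lambda>n. - int n)" for x
      by (cases x rule: int_cases2) auto
    then show ?thesis by blast
  qed
  ultimately show ?thesis by simp
qed

text \<open>The two derivatives beyond \<open>k\<close> leave the summable majorant
  \<open>C / japan n ^ 2\<close>. The case \<open>k = 0\<close> feeds Parseval, the case
  \<open>k = m\<close> the estimate for the potential.\<close>

lemma fcoef_test_summable:
  assumes D: "test_chain N \<alpha> \<beta> D" and "0 \<le> \<alpha>" "\<beta> \<le> 1" and N: "k + 2 \<le> N"
  shows "(\<lambda>n. norm (fcoef (\<lambda>x. complex_of_real (D 0 x)) n) * japan n ^ k) summable_on UNIV"
proof -
  obtain C where C: "\<And>n. norm (fcoef (\<lambda>x. complex_of_real (D 0 x)) n) * japan n ^ N \<le> C"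
    using fcoef_decay[OF D assms(2,3)] by blast
  have "(\<lambda>n. C * (1 / japan n ^ 2)) summable_on UNIV"
    by (intro summable_on_cmult_right summable_inverse_japan_square)
  then show ?thesis
  proof (rule summable_on_comparison_test)
    fix n
    have "japan n ^ (k + 2) \<le> japan n ^ N"
      using N japan_pos by (intro power_increasing)
    then have "norm (fcoef (\<lambda>x. complex_of_real (D 0 x)) n) * japan n ^ (k + 2) \<le> C"
      using C[of n] mult_left_mono[of _ _ "norm (fcoef (\<lambda>x. complex_of_real (D 0 x)) n)"] norm_ge_zero order_trans
      by meson
    then show "norm (fcoef (\<lambda>x. complex_of_real (D 0 x)) n) * japan n ^ k \<le> C * (1 / japan n ^ 2)"
      using japan_pos[of n] by (simp add: field_simps power_add power2_eq_square)
    show "0 \<le> norm (fcoef (\<lambda>x. complex_of_real (D 0 x)) n) * japan n ^ k"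
      using japan_pos[of n] by simp
  qed
qed

section \<open>Fourier inversion and Parseval\<close>

text \<open>Passes from the Lebesgue integral in \<open>fcoef\<close> to
  \<open>has_integral\<close>, in whose calculus the orthogonality computations are done.\<close>

lemma fcoef_continuous:
  assumes "continuous_on {0..1} f"
  shows "((\<lambda>x. f x * cis (- (real_of_int n * pi * x))) has_integral fcoef f n) {0..1}"
proof -
  have "set_integrable lborel {0..1} (\<lambda>x. f x * cis (- (real_of_int n * pi * x)))"
    by (intro borel_integrable_atLeastAtMost' continuous_intros assms)
  from set_borel_integral_eq_integral[OF this] show ?thesis
    by (simp add: fcoef_def has_integral_iff)
qed

section \<open>Orthonormality of the even modes and Bessel's inequality\<close>

text \<open>The even modes have period 1 and are orthonormal on the unit interval, whereas modes of
  different parity need not be orthogonal there. The Fourier theory is therefore developed for even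
  modes first.\<close>

lemma has_integral_cis_even:
  "((\<lambda>x. cis (2 * real_of_int k * pi * x)) has_integral (if k = 0 then 1 else 0)) {0..1}"
proof (cases "k = 0")
  case True
  then show ?thesis using has_integral_const_real[of "1::complex" 0 1] by simp
next
  case False
  define \<omega> where "\<omega> = 2 * \<i> * of_int k * of_real pi"
  have \<omega>: "\<omega> \<noteq> 0" using False by (simp add: \<omega>_def)
  have eq: "cis (2 * real_of_int k * pi * x) = exp (\<omega> * of_real x)" for x
    by (simp add: cis_conv_exp \<omega>_def algebra_simps)
  have "((\<lambda>x. exp (\<omega> * of_real x)) has_integral exp (\<omega> * of_real 1) / \<omega> - exp (\<omega> * of_real 0) / \<omega>) {0..1}"
  proof (rule fundamental_theorem_of_calculus)
    show "((\<lambda>x. exp (\<omega> * of_real x) / \<omega>) has_vector_derivative exp (\<omega> * of_real x)) (at x within {0..1})" for x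
      by (rule has_vector_derivative_real_field) (use \<omega> in \<open>auto intro!: derivative_eq_intros\<close>)
  qed auto
  moreover have "exp (\<omega> * of_real 1) = 1"
    unfolding exp_eq_1 using \<omega>_def by (auto intro!: exI[of _ k])
  ultimately show ?thesis using False by (simp add: eq)
qed

text \<open>With \<open>S\<close> the partial sum over \<open>F\<close>, expand the integral of
  \<open>(norm (h - S))\<^sup>2\<close>: both mixed terms and the square of \<open>S\<close>
  integrate to the same number \<open>b\<close>, so the result \<open>I - b\<close> is an integral
  of a nonnegative function.\<close>

lemma bessel_inequality:
  assumes h: "continuous_on {0..1} h" and F: "finite F"
  shows "(\<Sum>k\<in>F. (norm (fcoef h (2 * k)))\<^sup>2) \<le> integral {0..1} (\<lambda>x. (norm (h x))\<^sup>2)"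
proof -
  define e where "e k x = cis (2 * real_of_int k * pi * x)" for k and x :: real
  define c where "c k = fcoef h (2 * k)" for k
  define S where "S x = (\<Sum>k\<in>F. c k * e k x)" for x
  define b where "b = (\<Sum>k\<in>F. (norm (c k))\<^sup>2)"
  define I where "I = integral {0..1} (\<lambda>x. (norm (h x))\<^sup>2)"
  have ce: "continuous_on A (e k)" for A k
    unfolding e_def by (intro continuous_intros)
  have cS: "continuous_on A S" for A
    unfolding S_def by (intro continuous_intros ce)
  have hh: "((\<lambda>x. h x * cnj (h x)) has_integral of_real I) {0..1}"
  proof -
    have "((\<lambda>x. (norm (h x))\<^sup>2) has_integral I) {0..1}"
      unfolding I_def by (intro integrable_integral integrable_continuous_real continuous_intros h)
    from has_integral_linear[OF this bounded_linear_of_real[where ?'a = complex]] show ?thesis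
      unfolding o_def complex_norm_square .
  qed
  have hS: "((\<lambda>x. h x * cnj (S x)) has_integral of_real b) {0..1}"
  proof -
    have "((\<lambda>x. h x * cnj (e k x)) has_integral c k) {0..1}" for k
      using fcoef_continuous[OF h, of "2 * k"] by (simp add: e_def c_def cis_cnj)
    then have "((\<lambda>x. \<Sum>k\<in>F. cnj (c k) * (h x * cnj (e k x))) has_integral (\<Sum>k\<in>F. cnj (c k) * c k)) {0..1}"
      by (intro has_integral_sum F has_integral_mult_right)
    moreover have "(\<Sum>k\<in>F. cnj (c k) * c k) = of_real b"
      by (simp add: b_def complex_norm_square mult.commute del: of_real_power)
    moreover have "(\<Sum>k\<in>F. cnj (c k) * (h x * cnj (e k x))) = h x * cnj (S x)" for x
      by (simp add: S_def sum_distrib_left mult_ac)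
    ultimately show ?thesis by simp
  qed
  have Sh: "((\<lambda>x. S x * cnj (h x)) has_integral of_real b) {0..1}"
    using has_integral_cnj[of "\<lambda>x. h x * cnj (S x)" "of_real b" "{0..1}"] hS
    by (simp add: o_def mult.commute)
  have SS: "((\<lambda>x. S x * cnj (S x)) has_integral of_real b) {0..1}"
  proof -
    have "((\<lambda>x. e k x * cnj (e l x)) has_integral (if k = l then 1 else 0)) {0..1}" for k l
      using has_integral_cis_even[of "k - l"]
      by (simp add: e_def cis_cnj cis_mult algebra_simps)
    then have "((\<lambda>x. \<Sum>k\<in>F. \<Sum>l\<in>F. c k * cnj (c l) * (e k x * cnj (e l x))) has_integral
        (\<Sum>k\<in>F. \<Sum>l\<in>F. c k * cnj (c l) * (if k = l then 1 else 0))) {0..1}"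
      by (intro has_integral_sum F has_integral_mult_right)
    moreover have "(\<Sum>k\<in>F. \<Sum>l\<in>F. c k * cnj (c l) * (if k = l then 1 else 0)) = of_real b"
      using F by (simp add: b_def complex_norm_square if_distrib sum.delta cong: if_cong del: of_real_power)
    moreover have "(\<Sum>k\<in>F. \<Sum>l\<in>F. c k * cnj (c l) * (e k x * cnj (e l x))) = S x * cnj (S x)" for x
      by (simp add: S_def sum_product mult_ac)
    ultimately show ?thesis by simp
  qed
  have "((\<lambda>x. h x * cnj (h x) - h x * cnj (S x) - S x * cnj (h x) + S x * cnj (S x)) has_integral
      (of_real I - of_real b - of_real b + of_real b)) {0..1}"
    by (intro has_integral_add has_integral_diff hh hS Sh SS)
  moreover have "h x * cnj (h x) - h x * cnj (S x) - S x * cnj (h x) + S x * cnj (S x)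
      = of_real ((norm (h x - S x))\<^sup>2)" for x
    unfolding complex_norm_square by (simp add: algebra_simps)
  ultimately have "((\<lambda>x. complex_of_real ((norm (h x - S x))\<^sup>2)) has_integral of_real (I - b)) {0..1}"
    by simp
  from has_integral_Re[OF this] have "((\<lambda>x. (norm (h x - S x))\<^sup>2) has_integral (I - b)) {0..1}"
    by (simp only: Re_complex_of_real)
  then have "0 \<le> I - b" by (rule has_integral_nonneg) auto
  then show ?thesis by (simp add: I_def b_def c_def)
qed

text \<open>A Riemann-Lebesgue statement: by Bessel the squared coefficients along distinct modes
  are summable. The free injection \<open>k\<close> serves both ends of the integers.\<close>

lemma fcoef_even_tendsto_0:
  assumes h: "continuous_on {0..1} h" and k: "inj k"
  shows "(\<lambda>n::nat. fcoef h (2 * k n)) \<longlonglongrightarrow> 0"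
proof -
  have "summable (\<lambda>n. (norm (fcoef h (2 * k n)))\<^sup>2)"
  proof (rule summableI_nonneg_bounded)
    fix n
    have "(\<Sum>i<n. (norm (fcoef h (2 * k i)))\<^sup>2) = (\<Sum>j\<in>k ` {..<n}. (norm (fcoef h (2 * j)))\<^sup>2)"
      using k by (subst sum.reindex) (auto intro: inj_on_subset)
    also have "\<dots> \<le> integral {0..1} (\<lambda>x. (norm (h x))\<^sup>2)"
      by (rule bessel_inequality[OF h]) auto
    finally show "(\<Sum>i<n. (norm (fcoef h (2 * k i)))\<^sup>2) \<le> integral {0..1} (\<lambda>x. (norm (h x))\<^sup>2)" .
  qed auto
  then have "(\<lambda>n. (norm (fcoef h (2 * k n)))\<^sup>2) \<longlonglongrightarrow> 0" by (rule summable_LIMSEQ_zero)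
  from tendsto_real_sqrt[OF this] show ?thesis by (simp add: tendsto_norm_zero_iff)
qed

section \<open>Pointwise Fourier inversion\<close>

lemma has_vector_derivative_quotient:
  assumes "(f has_vector_derivative f') (at x0)"
  shows "((\<lambda>x. (1 / (x - x0)) *\<^sub>R (f x - f x0)) \<longlongrightarrow> f') (at x0)"
proof (rule LIM_zero_cancel, rule tendsto_norm_zero_cancel)
  have "((\<lambda>y. norm ((f y - f x0) - (y - x0) *\<^sub>R f') / norm (y - x0)) \<longlongrightarrow> 0) (at x0)"
    using assms by (simp add: has_vector_derivative_def has_derivative_iff_norm)
  then show "((\<lambda>x. norm ((1 / (x - x0)) *\<^sub>R (f x - f x0) - f')) \<longlongrightarrow> 0) (at x0)"
  proof (rule Lim_transform_eventually)
    have "norm ((f y - f x0) - (y - x0) *\<^sub>R f') / norm (y - x0) = norm ((1 / (y - x0)) *\<^sub>R (f y - f x0) - f')"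
      if "y \<noteq> x0" for y
    proof -
      have "(1 / (y - x0)) *\<^sub>R (f y - f x0) - f' = (1 / (y - x0)) *\<^sub>R ((f y - f x0) - (y - x0) *\<^sub>R f')"
        using that by (simp add: scaleR_diff_right)
      then show ?thesis by (simp add: divide_inverse abs_inverse mult.commute)
    qed
    then show "\<forall>\<^sub>F y in at x0. norm ((f y - f x0) - (y - x0) *\<^sub>R f') / norm (y - x0)
        = norm ((1 / (y - x0)) *\<^sub>R (f y - f x0) - f')"
      by (auto simp: eventually_at_filter)
  qed
qed

text \<open>Chernoff's argument: dividing \<open>f - f x0\<close> by \<open>cis (2 * pi * x) - cis (2 * pi * x0)\<close> turns the
  partial sums of the Fourier series into telescoping sums.\<close>

lemma fourier_even_pointwise:
  assumes f: "continuous_on {0..1} f" and x0: "0 < x0" "x0 < 1"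
    and f': "(f has_vector_derivative f') (at x0)"
  shows "(\<lambda>K::nat. \<Sum>k\<in>{-int K..int K}. fcoef f (2 * k) * cis (2 * real_of_int k * pi * x0)) \<longlonglongrightarrow> f x0"
proof -
  define e where "e k x = cis (2 * real_of_int k * pi * x)" for k and x :: real
  have e_add: "e (k + l) x = e k x * e l x" for k l x
    by (simp add: e_def cis_mult algebra_simps)
  have e0[simp]: "e 0 x = 1" for x by (simp add: e_def)
  \<comment> \<open>As \<open>x0\<close> lies strictly inside the unit interval,
    \<open>x - x0\<close> lies strictly between -1 and 1 and is an integer only if it is 0; the
    quotient has \<open>x0\<close> as its only singularity.\<close>
  have e_ne: "e 1 x - e 1 x0 \<noteq> 0" if "x \<in> {0..1}" "x \<noteq> x0" for x
  proof
    assume "e 1 x - e 1 x0 = 0"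
    then have "cis (2 * pi * x - 2 * pi * x0) = 1" by (simp add: e_def cis_divide[symmetric])
    then have "cos (2 * pi * x - 2 * pi * x0) = 1" by (simp add: complex_eq_iff)
    then obtain n :: int where "2 * pi * x - 2 * pi * x0 = of_int n * (2 * pi)"
      by (auto simp: cos_one_2pi_int)
    then have "2 * pi * (x - x0) = 2 * pi * of_int n" by (simp add: algebra_simps)
    then have n: "x - x0 = of_int n" by (subst (asm) mult_cancel_left) auto
    then have "real_of_int n < 1" "real_of_int n > -1" using that x0 by auto
    then have "n = 0" by linarith
    then show False using n that by simp
  qed
  have e': "(e 1 has_vector_derivative (2 * of_real pi * \<i>) * e 1 x0) (at x0)"
  proof -
    have e: "e 1 = (\<lambda>x. exp (2 * of_real pi * \<i> * of_real x))"
      by (auto simp: e_def cis_conv_exp algebra_simps)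
    show ?thesis unfolding e
      by (rule has_vector_derivative_real_field) (auto intro!: derivative_eq_intros)
  qed
  \<comment> \<open>\<open>L\<close> is the quotient of the derivatives of \<open>f\<close> and
    \<open>e 1\<close> at \<open>x0\<close>. Inserting it there removes the singularity and makes
    \<open>h\<close> continuous.\<close>
  define L where "L = f' / (2 * of_real pi * \<i> * e 1 x0)"
  define h where "h x = (if x = x0 then L else (f x - f x0) / (e 1 x - e 1 x0))" for x
  have "((\<lambda>x. (f x - f x0) / (e 1 x - e 1 x0)) \<longlongrightarrow> L) (at x0)"
  proof -
    have "((\<lambda>x. (1 / (x - x0)) *\<^sub>R (f x - f x0)) \<longlongrightarrow> f') (at x0)"
      by (rule has_vector_derivative_quotient[OF f'])
    moreover have "((\<lambda>x. (1 / (x - x0)) *\<^sub>R (e 1 x - e 1 x0)) \<longlongrightarrow> (2 * of_real pi * \<i>) * e 1 x0) (at x0)"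
      by (rule has_vector_derivative_quotient[OF e'])
    ultimately have "((\<lambda>x. ((1 / (x - x0)) *\<^sub>R (f x - f x0)) / ((1 / (x - x0)) *\<^sub>R (e 1 x - e 1 x0))) \<longlongrightarrow> L) (at x0)"
      unfolding L_def by (intro tendsto_divide) (auto simp: e_def)
    then show ?thesis
      by (rule Lim_transform_eventually)
         (auto simp: eventually_at_filter scaleR_conv_of_real intro!: always_eventually)
  qed
  then have "(h \<longlongrightarrow> L) (at x0)"
    by (rule Lim_transform_eventually) (auto simp: eventually_at_filter h_def)
  then have "isCont h x0"
    unfolding isCont_def by (simp add: h_def[of x0])
  have ce: "continuous_on A (e k)" for A k
    unfolding e_def by (intro continuous_intros)
  have h: "continuous_on {0..1} h"
    unfolding continuous_on_eq_continuous_within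
  proof
    fix x :: real assume x: "x \<in> {0..1}"
    show "continuous (at x within {0..1}) h"
    proof (cases "x = x0")
      case True
      then show ?thesis using \<open>isCont h x0\<close> continuous_at_imp_continuous_at_within by blast
    next
      case False
      have "continuous (at x within {0..1}) (\<lambda>x. (f x - f x0) / (e 1 x - e 1 x0))"
        using f ce[of "{0..1}" 1] x e_ne[OF x False]
        by (intro continuous_intros) (auto simp: continuous_on_eq_continuous_within)
      moreover have "\<forall>\<^sub>F y in at x within {0..1}. (f y - f x0) / (e 1 y - e 1 x0) = h y"
        using eventually_neq_at_within[of x0 x "{0..1}"] by eventually_elim (simp add: h_def)
      ultimately show ?thesis
        using False unfolding continuous_within h_def by (auto elim: Lim_transform_eventually)
    qed
  qed
  define H where "H k = fcoef h (2 * k)" for k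
  \<comment> \<open>Take coefficients in \<open>f = f x0 + h * (e 1 - e 1 x0)\<close>. Multiplying
    by \<open>e 1\<close> shifts the index of \<open>H\<close> by one, so after the factor
    \<open>e k x0\<close> the last two terms are values at \<open>k\<close> and \<open>k + 1\<close>
    of the single sequence \<open>H (k - 1) * e k x0\<close>, and they telescope.\<close>
  have rec: "fcoef f (2 * k) * e k x0 = (if k = 0 then f x0 else 0) + (H (k - 1) * e k x0 - H k * e (k + 1) x0)" for k
  proof -
    have "((\<lambda>x. h x * e (- k) x) has_integral H k) {0..1}" for k
      using fcoef_continuous[OF h, of "2 * k"] by (simp add: H_def e_def)
    note H = this
    have "((\<lambda>x. f x0 * e (- k) x + (h x * e (- (k - 1)) x - e 1 x0 * (h x * e (- k) x))) has_integral
       (f x0 * (if - k = 0 then 1 else 0) + (H (k - 1) - e 1 x0 * H k))) {0..1}"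
      by (intro has_integral_add has_integral_diff has_integral_mult_right H)
         (unfold e_def, rule has_integral_cis_even)
    moreover have "f x0 * e (- k) x + (h x * e (- (k - 1)) x - e 1 x0 * (h x * e (- k) x)) = f x * e (- k) x"
      if "x \<in> {0..1}" for x
    proof -
      have "h x * (e 1 x - e 1 x0) = f x - f x0"
        using e_ne[OF that] by (auto simp: h_def)
      moreover have "e (- (k - 1)) x = e 1 x * e (- k) x"
        using e_add[of 1 "- k" x] by simp
      moreover have "f x0 * e (- k) x + (h x * (e 1 x * e (- k) x) - e 1 x0 * (h x * e (- k) x))
          = (f x0 + h x * (e 1 x - e 1 x0)) * e (- k) x"
        by (simp add: algebra_simps)
      ultimately show ?thesis by simp
    qed
    ultimately have "((\<lambda>x. f x * e (- k) x) has_integral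
       (f x0 * (if - k = 0 then 1 else 0) + (H (k - 1) - e 1 x0 * H k))) {0..1}"
      by (rule has_integral_eq[rotated]) 
    moreover have "((\<lambda>x. f x * e (- k) x) has_integral fcoef f (2 * k)) {0..1}"
      using fcoef_continuous[OF f, of "2 * k"] by (simp add: e_def)
    ultimately have "fcoef f (2 * k) = f x0 * (if - k = 0 then 1 else 0) + (H (k - 1) - e 1 x0 * H k)"
      using has_integral_unique by blast
    then have eq: "fcoef f (2 * k) = (if k = 0 then f x0 else 0) + (H (k - 1) - e 1 x0 * H k)" by simp
    show ?thesis unfolding eq e_add[of k 1 x0] by (cases "k = 0") (simp_all add: algebra_simps)
  qed
  have part: "(\<Sum>k\<in>{-int K..int K}. fcoef f (2 * k) * e k x0)
      = f x0 + (H (- int K - 1) * e (- int K) x0 - H (int K) * e (int K + 1) x0)" for K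
  proof (induction K)
    case 0
    then show ?case using rec[of 0] by simp
  next
    case (Suc K)
    define t where "t k = fcoef f (2 * k) * e k x0" for k
    have "{-int (Suc K)..int (Suc K)} = insert (- int K - 1) (insert (int K + 1) {-int K..int K})"
      by auto
    then have "sum t {-int (Suc K)..int (Suc K)} = t (- int K - 1) + (t (int K + 1) + sum t {-int K..int K})"
      by simp
    moreover have "t (- int K - 1) = H (- int K - 2) * e (- int K - 1) x0 - H (- int K - 1) * e (- int K) x0"
    proof -
      have "- int K - 1 - 1 = - int K - 2" "- int K - 1 + 1 = - int K" "- int K - 1 \<noteq> 0" by auto
      then show ?thesis unfolding t_def rec[of "- int K - 1"] by (simp only: if_False add_0_left)
    qed
    moreover have "t (int K + 1) = H (int K) * e (int K + 1) x0 - H (int K + 1) * e (int K + 2) x0"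
    proof -
      have "int K + 1 - 1 = int K" "int K + 1 + 1 = int K + 2" "int K + 1 \<noteq> 0" by auto
      then show ?thesis unfolding t_def rec[of "int K + 1"] by (simp only: if_False add_0_left)
    qed
    moreover have "sum t {-int K..int K} = f x0 + (H (- int K - 1) * e (- int K) x0 - H (int K) * e (int K + 1) x0)"
      using Suc.IH by (simp add: t_def)
    ultimately have "sum t {-int (Suc K)..int (Suc K)}
        = f x0 + (H (- int K - 2) * e (- int K - 1) x0 - H (int K + 1) * e (int K + 2) x0)"
      by simp
    moreover have "- int (Suc K) = - int K - 1" "- int (Suc K) - 1 = - int K - 2"
      "int (Suc K) = int K + 1" "int (Suc K) + 1 = int K + 2" by auto
    ultimately show ?case unfolding t_def by (simp only:)
  qed
  \<comment> \<open>The two surviving end terms are coefficients of the continuous function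
    \<open>h\<close> times unimodular factors, so they tend to 0.\<close>
  have "(\<lambda>K. H (- int K - 1) * e (- int K) x0) \<longlonglongrightarrow> 0"
    by (rule tendsto_norm_zero_cancel)
       (use tendsto_norm_zero[OF fcoef_even_tendsto_0[OF h, of "\<lambda>K. - int K - 1"]] in
         \<open>simp add: norm_mult e_def H_def inj_def\<close>)
  moreover have "(\<lambda>K. H (int K) * e (int K + 1) x0) \<longlonglongrightarrow> 0"
    by (rule tendsto_norm_zero_cancel)
       (use tendsto_norm_zero[OF fcoef_even_tendsto_0[OF h, of int]] in
         \<open>simp add: norm_mult e_def H_def inj_def\<close>)
  ultimately have "(\<lambda>K. f x0 + (H (- int K - 1) * e (- int K) x0 - H (int K) * e (int K + 1) x0)) \<longlonglongrightarrow> f x0 + (0 - 0)"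
    by (intro tendsto_intros)
  then have "(\<lambda>K. \<Sum>k\<in>{-int K..int K}. fcoef f (2 * k) * e k x0) \<longlonglongrightarrow> f x0 + (0 - 0)"
    by (simp only: part)
  then show ?thesis by (simp add: e_def)
qed

text \<open>Symmetric intervals eventually contain every finite set of integers. Hence an
  unconditional sum, once it exists, is the limit of the symmetric partial sums.\<close>

lemma filterlim_symmetric_int_intervals:
  "filterlim (\<lambda>K::nat. {- int K..int K}) (finite_subsets_at_top UNIV) sequentially"
  unfolding filterlim_finite_subsets_at_top
proof safe
  fix X :: "int set" assume "finite X"
  define M where "M = Max (insert 0 (abs ` X))"
  have M: "\<bar>x\<bar> \<le> M" if "x \<in> X" for x
    unfolding M_def using \<open>finite X\<close> that by (intro Max_ge) auto
  show "\<forall>\<^sub>F K in sequentially. finite {- int K..int K} \<and> X \<subseteq> {- int K..int K} \<and> {- int K..int K} \<subseteq> UNIV"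
    using eventually_ge_at_top[of "nat M"]
  proof eventually_elim
    case (elim K)
    then have "M \<le> int K" by linarith
    then show ?case using M by force
  qed
qed

text \<open>Odd modes reduce to even ones by multiplying \<open>f\<close> with
  \<open>cis (- pi * x)\<close>, which shifts the coefficients by \<open>r = 1\<close>; for even
  modes \<open>r = 0\<close>. Absolute summability supplies an unconditional sum, and the pointwise
  limit of the symmetric partial sums identifies its value.\<close>

lemma fourier_parity_has_sum:
  assumes f: "continuous_on {0..1} f" and x0: "0 < x0" "x0 < 1"
    and f': "(f has_vector_derivative f') (at x0)"
    and sm: "(\<lambda>n. norm (fcoef f n)) summable_on {n. even n = p}"
  shows "((\<lambda>n. fcoef f n * cis (real_of_int n * pi * x0)) has_sum f x0) {n. even n = p}"
proof -
  define r :: int where "r = (if p then 0 else 1)"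
  define q where "q x = cis (- (real_of_int r * pi * x))" for x
  have cq: "continuous_on A q" for A
    unfolding q_def by (intro continuous_intros)
  have q: "q = (\<lambda>x. exp (- (\<i> * of_int r * of_real pi) * of_real x))"
    by (auto simp: q_def cis_conv_exp algebra_simps)
  have "(q has_vector_derivative - (\<i> * of_int r * of_real pi) * q x0) (at x0)"
    unfolding q by (rule has_vector_derivative_real_field) (auto intro!: derivative_eq_intros)
  from has_vector_derivative_mult[OF f' this]
  have "(\<lambda>K::nat. \<Sum>k\<in>{-int K..int K}. fcoef (\<lambda>x. f x * q x) (2 * k) * cis (2 * real_of_int k * pi * x0))
      \<longlonglongrightarrow> f x0 * q x0"
    by (intro fourier_even_pointwise continuous_intros f cq x0) 
  moreover have "fcoef (\<lambda>x. f x * q x) (2 * k) = fcoef f (2 * k + r)" for k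
    unfolding fcoef_def q_def
    by (intro arg_cong[where f = "\<lambda>f. set_lebesgue_integral lborel {0..1} f"] ext)
       (simp add: cis_mult algebra_simps)
  ultimately have twisted: "(\<lambda>K::nat. (\<Sum>k\<in>{-int K..int K}. fcoef f (2 * k + r) * cis (2 * real_of_int k * pi * x0)) * cis (real_of_int r * pi * x0))
      \<longlonglongrightarrow> f x0 * q x0 * cis (real_of_int r * pi * x0)"
    by (intro tendsto_mult_right) simp
  have lim: "(\<lambda>K::nat. \<Sum>k\<in>{-int K..int K}. fcoef f (2 * k + r) * cis (real_of_int (2 * k + r) * pi * x0)) \<longlonglongrightarrow> f x0"
  proof -
    have "cis (2 * real_of_int k * pi * x0) * cis (real_of_int r * pi * x0) = cis (real_of_int (2 * k + r) * pi * x0)" for k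
      by (simp add: cis_mult algebra_simps)
    moreover have "q x0 * cis (real_of_int r * pi * x0) = 1"
      by (simp add: q_def cis_mult)
    ultimately show ?thesis
      using twisted
      by (simp only: sum_distrib_right mult.assoc mult_1_right)
  qed
  let ?t = "\<lambda>n. fcoef f n * cis (real_of_int n * pi * x0)"
  have bij: "bij_betw (\<lambda>k. 2 * k + r) UNIV {n. even n = p}"
  proof (rule bij_betwI[where g = "\<lambda>n. (n - r) div 2"])
    show "(\<lambda>k. 2 * k + r) \<in> UNIV \<rightarrow> {n. even n = p}" by (auto simp: r_def)
  qed (auto simp: r_def elim!: oddE)
  have "(\<lambda>n. norm (?t n)) summable_on {n. even n = p}"
    using sm by (simp add: norm_mult)
  then have "?t summable_on {n. even n = p}"
    by (rule Infinite_Sum.abs_summable_summable)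
  then have "(\<lambda>k. ?t (2 * k + r)) summable_on UNIV"
    using summable_on_reindex_bij_betw[OF bij, of ?t] by simp
  then obtain s where s: "((\<lambda>k. ?t (2 * k + r)) has_sum s) UNIV"
    by (auto simp: summable_on_def)
  then have "(\<lambda>K::nat. \<Sum>k\<in>{-int K..int K}. ?t (2 * k + r)) \<longlonglongrightarrow> s"
    unfolding has_sum_def by (rule filterlim_compose[OF _ filterlim_symmetric_int_intervals])
  with lim have "s = f x0" using LIMSEQ_unique by blast
  then show ?thesis using s has_sum_reindex_bij_betw[OF bij, of ?t] by simp
qed

section \<open>Parseval's identity in one parity\<close>

text \<open>Since \<open>w\<close> is merely integrable, regularity is asked of \<open>f\<close>:
  its partial sums converge uniformly on the open unit interval, and the error of the pairing is at
  most the L1 norm of \<open>w\<close> times the tail of the absolute coefficient sum. Either parity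
  suffices, because each one alone recovers \<open>f\<close>.\<close>

lemma parseval_smooth:
  fixes w f :: "real \<Rightarrow> complex"
  assumes w: "set_integrable lborel {0..1} w"
    and f: "continuous_on UNIV f" and diff: "\<And>x. f differentiable at x"
    and sm: "(\<lambda>n. norm (fcoef f n)) summable_on UNIV"
  shows "((\<lambda>n. fcoef f (- n) * fcoef w n) has_sum (LINT x:{0..1}|lborel. w x * f x)) {n. even n = p}"
proof -
  define P where "P = {n::int. even n = p}"
  \<comment> \<open>The pairing is bilinear, without conjugation, so \<open>fcoef w n\<close> meets
    the coefficient of \<open>f\<close> at the reflected mode \<open>- n\<close>.\<close>
  define \<psi> where "\<psi> n = fcoef f (- n)" for n
  define S where "S F x = (\<Sum>n\<in>F. \<psi> n * cis (- (real_of_int n * pi * x)))" for F x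
  define I where "I = (LINT x:{0..1}|lborel. w x * f x)"
  define W where "W = (LINT x:{0..1}|lborel. norm (w x))"
  have \<psi>: "(\<lambda>n. norm (\<psi> n)) summable_on P"
  proof -
    have "(\<lambda>n. norm (fcoef f n)) summable_on P"
      using sm summable_on_subset_banach by blast
    moreover have "bij_betw uminus P P"
      by (rule bij_betwI[where g = uminus]) (auto simp: P_def)
    ultimately show ?thesis
      using summable_on_reindex_bij_betw[of uminus P P "\<lambda>n. norm (fcoef f n)"] by (simp add: \<psi>_def)
  qed
  then obtain T where T: "((\<lambda>n. norm (\<psi> n)) has_sum T) P" by (auto simp: summable_on_def)
  have inv: "((\<lambda>n. \<psi> n * cis (- (real_of_int n * pi * x))) has_sum f x) P" if "0 < x" "x < 1" for x
  proof -
    have "((\<lambda>n. fcoef f n * cis (real_of_int n * pi * x)) has_sum f x) P"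
      unfolding P_def
    proof (rule fourier_parity_has_sum[OF continuous_on_subset[OF f subset_UNIV] that])
      show "(f has_vector_derivative vector_derivative f (at x)) (at x)"
        using diff by (simp flip: vector_derivative_works)
      show "(\<lambda>n. norm (fcoef f n)) summable_on {n. even n = p}"
        using sm summable_on_subset_banach by blast
    qed
    moreover have "bij_betw uminus P P"
      by (rule bij_betwI[where g = uminus]) (auto simp: P_def)
    ultimately show ?thesis
      using has_sum_reindex_bij_betw[of uminus P P "\<lambda>n. fcoef f n * cis (real_of_int n * pi * x)"]
      by (simp add: \<psi>_def)
  qed
  have cS: "continuous_on A (S F)" for A F
    unfolding S_def by (intro continuous_intros)
  have wS: "(\<Sum>n\<in>F. \<psi> n * fcoef w n) = (LINT x:{0..1}|lborel. w x * S F x)" if "finite F" for F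
  proof -
    have i: "set_integrable lborel {0..1} (\<lambda>x. w x * cis (- (real_of_int n * pi * x)))" for n
      using set_integrable_mult_cis[OF w, of "- (real_of_int n * pi)"] by simp
    have "(\<Sum>n\<in>F. \<psi> n * fcoef w n) = (\<Sum>n\<in>F. (LINT x:{0..1}|lborel. \<psi> n * (w x * cis (- (real_of_int n * pi * x)))))"
      by (simp add: fcoef_def)
    also have "\<dots> = (LINT x:{0..1}|lborel. (\<Sum>n\<in>F. \<psi> n * (w x * cis (- (real_of_int n * pi * x)))))"
      unfolding set_lebesgue_integral_def scaleR_sum_right
      using set_integrable_mult_right[OF i] unfolding set_integrable_def
      by (intro Bochner_Integration.integral_sum[symmetric]) simp
    finally show ?thesis by (simp add: S_def sum_distrib_left mult_ac)
  qed
  have wc: "set_integrable lborel {0..1} (\<lambda>x. w x * h x)" if h: "continuous_on UNIV h" for h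
  proof -
    have "bounded (h ` {0..1})"
      by (intro compact_imp_bounded compact_continuous_image continuous_on_subset[OF h]) auto
    then obtain B where "\<forall>y\<in>h ` {0..1}. norm y \<le> B"
      unfolding bounded_iff by blast
    then show ?thesis
      using h by (intro set_integrable_mult_bounded[OF w, of _ B]) (auto simp: borel_measurable_continuous_onI)
  qed
  have bound: "norm ((\<Sum>n\<in>F. \<psi> n * fcoef w n) - I) \<le> W * (T - (\<Sum>n\<in>F. norm (\<psi> n)))"
    if F: "finite F" "F \<subseteq> P" for F
  proof -
    define \<tau> where "\<tau> = T - (\<Sum>n\<in>F. norm (\<psi> n))"
    have tail: "norm (S F x - f x) \<le> \<tau>" if "0 < x" "x < 1" for x
    proof -
      have "((\<lambda>n. \<psi> n * cis (- (real_of_int n * pi * x))) has_sum (f x - S F x)) (P - F)"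
        unfolding S_def by (intro has_sum_Diff inv that has_sum_finite F)
      moreover have "((\<lambda>n. norm (\<psi> n)) has_sum \<tau>) (P - F)"
        unfolding \<tau>_def by (intro has_sum_Diff T has_sum_finite F)
      ultimately have "norm (f x - S F x) \<le> \<tau>"
        by (rule norm_infsum_le) (simp add: norm_mult)
      then show ?thesis by (simp add: norm_minus_commute)
    qed
    have "(\<Sum>n\<in>F. \<psi> n * fcoef w n) - I = (LINT x:{0..1}|lborel. w x * S F x - w x * f x)"
      unfolding wS[OF F(1)] I_def by (intro set_integral_diff(2)[symmetric] wc cS f)
    also have "norm \<dots> \<le> (LINT x:{0..1}|lborel. norm (w x * S F x - w x * f x))"
      by (intro set_integral_norm_bound set_integral_diff wc cS f)
    also have "\<dots> \<le> (LINT x:{0..1}|lborel. norm (w x) * \<tau>)"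
    proof (rule set_integral_mono_AE)
      show "set_integrable lborel {0..1} (\<lambda>x. norm (w x * S F x - w x * f x))"
        by (intro set_integrable_norm set_integral_diff wc cS f)
      show "set_integrable lborel {0..1} (\<lambda>x. norm (w x) * \<tau>)"
        using w by (intro set_integrable_mult_left set_integrable_norm)
      \<comment> \<open>Inversion holds only in the open interval; the endpoints 0 and 1 are
        discarded as null sets.\<close>
      show "AE x in lborel. x \<in> {0..1} \<longrightarrow> norm (w x * S F x - w x * f x) \<le> norm (w x) * \<tau>"
        using AE_lborel_singleton[of 0] AE_lborel_singleton[of 1]
      proof eventually_elim
        case (elim x)
        show ?case
        proof
          assume "x \<in> {0..1}"
          then have "norm (S F x - f x) \<le> \<tau>" using elim tail[of x] by auto
          then show "norm (w x * S F x - w x * f x) \<le> norm (w x) * \<tau>"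
            by (simp add: norm_mult mult_left_mono flip: right_diff_distrib)
        qed
      qed
    qed
    also have "\<dots> = W * \<tau>" by (simp add: W_def)
    finally show ?thesis by (simp add: \<tau>_def)
  qed
  have "((\<lambda>F. W * (T - (\<Sum>n\<in>F. norm (\<psi> n)))) \<longlongrightarrow> W * (T - T)) (finite_subsets_at_top P)"
    using T unfolding has_sum_def by (intro tendsto_intros)
  then have "((\<lambda>F. (\<Sum>n\<in>F. \<psi> n * fcoef w n) - I) \<longlongrightarrow> 0) (finite_subsets_at_top P)"
  proof (rule Lim_null_comparison[rotated, OF tendsto_eq_rhs])
    show "\<forall>\<^sub>F F in finite_subsets_at_top P. norm ((\<Sum>n\<in>F. \<psi> n * fcoef w n) - I)
        \<le> W * (T - (\<Sum>n\<in>F. norm (\<psi> n)))"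
      by (rule eventually_finite_subsets_at_top_weakI) (rule bound)
  qed simp
  then have "((\<lambda>n. \<psi> n * fcoef w n) has_sum I) P"
    unfolding has_sum_def by (simp add: LIM_zero_iff)
  then show ?thesis by (simp add: \<psi>_def I_def P_def)
qed

section \<open>Locality\<close>

lemma japan_diff_le: "japan (n - j) \<le> japan n * japan j"
proof -
  have "\<bar>real_of_int (n - j)\<bar> \<le> \<bar>real_of_int n\<bar> + \<bar>real_of_int j\<bar>" by linarith
  moreover have "0 \<le> \<bar>real_of_int n\<bar> * \<bar>real_of_int j\<bar>" by simp
  moreover have "japan n * japan j
      = 1 + \<bar>real_of_int n\<bar> + \<bar>real_of_int j\<bar> + \<bar>real_of_int n\<bar> * \<bar>real_of_int j\<bar>"
    by (simp add: japan_def algebra_simps)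
  ultimately show ?thesis by (simp only: japan_def of_int_abs)
qed

text \<open>Submultiplicativity of \<open>japan\<close> distributes the weight of \<open>V (n - j)\<close> over \<open>\<psi> n\<close> and \<open>c j\<close>.\<close>

lemma convolution_abs_summable:
  fixes V c \<psi> :: "int \<Rightarrow> complex"
  assumes V: "(\<lambda>n. japan n powr (2 * - real m) * (norm (V n))\<^sup>2) summable_on UNIV"
    and c: "(\<lambda>n. japan n powr (2 * real m) * (norm (c n))\<^sup>2) summable_on UNIV"
    and \<psi>: "(\<lambda>n. norm (\<psi> n) * japan n ^ m) summable_on UNIV"
  shows "(\<lambda>(n, j). norm (\<psi> n * (V (n - j) * c j))) summable_on (UNIV \<times> UNIV)"
proof -
  define w where "w n = norm (V n) / japan n ^ m" for n
  define v where "v n = norm (c n) * japan n ^ m" for n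
  have jp: "japan n powr (2 * real m) = (japan n ^ m)\<^sup>2" for n
    using japan_pos[of n] powr_realpow[of "japan n" "m * 2"] by (simp add: power_mult mult.commute)
  have jm: "japan n powr (2 * - real m) = inverse ((japan n ^ m)\<^sup>2)" for n
    using jp[of n] by (simp add: powr_minus)
  from V have "(\<lambda>n. (w n)\<^sup>2) summable_on UNIV"
    unfolding jm w_def by (simp add: power_divide divide_inverse power_mult_distrib power_inverse mult.commute)
  then obtain W where W: "((\<lambda>n. (w n)\<^sup>2) has_sum W) UNIV" by (auto simp: summable_on_def)
  from c have "(\<lambda>n. (v n)\<^sup>2) summable_on UNIV"
    unfolding jp v_def by (simp add: power_mult_distrib mult.commute)
  then obtain U where U: "((\<lambda>n. (v n)\<^sup>2) has_sum U) UNIV" by (auto simp: summable_on_def)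
  define a where "a n = norm (\<psi> n) * japan n ^ m" for n
  have a0: "a n \<ge> 0" for n using japan_pos[of n] by (simp add: a_def)
  \<comment> \<open>The product \<open>w (n - j) * v j\<close> is dominated by the sum of the
    squares. By translation invariance the sum over \<open>j\<close> is then \<open>W + U\<close>
    for every \<open>n\<close>, and only the weighted sum of \<open>\<psi>\<close> remains.\<close>
  have "(\<lambda>(n, j). a n * ((w (n - j))\<^sup>2 + (v j)\<^sup>2)) summable_on (UNIV \<times> UNIV)"
  proof (rule summable_on_SigmaI)
    fix n :: int
    have "bij_betw (\<lambda>j. n - j) UNIV UNIV"
      by (rule bij_betwI[where g = "\<lambda>j. n - j"]) auto
    then have "((\<lambda>j. (w (n - j))\<^sup>2) has_sum W) UNIV"
      using has_sum_reindex_bij_betw[of "\<lambda>j. n - j" UNIV UNIV "\<lambda>n. (w n)\<^sup>2" W] W by simp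
    then show "((\<lambda>j. case (n, j) of (n, j) \<Rightarrow> a n * ((w (n - j))\<^sup>2 + (v j)\<^sup>2)) has_sum a n * (W + U)) UNIV"
      unfolding prod.case by (intro has_sum_cmult_right has_sum_add U)
  next
    show "(\<lambda>n. a n * (W + U)) summable_on UNIV"
      using \<psi> by (intro summable_on_cmult_left) (simp add: a_def)
  qed (use a0 in auto)
  then show ?thesis
  proof (rule summable_on_comparison_test)
    fix z :: "int \<times> int"
    obtain n j where z: "z = (n, j)" by (cases z)
    have "norm (V (n - j)) = w (n - j) * japan (n - j) ^ m"
      using japan_pos[of "n - j"] by (simp add: w_def)
    also have "\<dots> \<le> w (n - j) * (japan n * japan j) ^ m"
      using japan_pos[of "n - j"] by (intro mult_left_mono power_mono japan_diff_le) (auto simp: w_def)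
    finally have "norm (V (n - j)) * norm (c j) \<le> w (n - j) * (japan n * japan j) ^ m * norm (c j)"
      by (rule mult_right_mono) simp
    then have "norm (\<psi> n) * (norm (V (n - j)) * norm (c j)) \<le> norm (\<psi> n) * (w (n - j) * (japan n * japan j) ^ m * norm (c j))"
      by (rule mult_left_mono) simp
    also have "\<dots> = a n * (w (n - j) * v j)"
      by (simp add: a_def v_def power_mult_distrib mult_ac)
    also have "\<dots> \<le> a n * ((w (n - j))\<^sup>2 + (v j)\<^sup>2)"
    proof (rule mult_left_mono[OF _ a0])
      have "2 * w (n - j) * v j \<le> (w (n - j))\<^sup>2 + (v j)\<^sup>2" by (rule sum_squares_bound)
      moreover have "w (n - j) * v j \<ge> 0"
        using japan_pos[of j] japan_pos[of "n - j"] by (simp add: w_def v_def)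
      ultimately show "w (n - j) * v j \<le> (w (n - j))\<^sup>2 + (v j)\<^sup>2" by linarith
    qed
    finally show "(case z of (n, j) \<Rightarrow> norm (\<psi> n * (V (n - j) * c j)))
        \<le> (case z of (n, j) \<Rightarrow> a n * ((w (n - j))\<^sup>2 + (v j)\<^sup>2))"
      by (simp add: z norm_mult)
    show "0 \<le> (case z of (n, j) \<Rightarrow> norm (\<psi> n * (V (n - j) * c j)))"
      by (simp add: z)
  qed
qed

section \<open>Pairing with test functions\<close>

text \<open>The unit interval has finite measure, and \<open>t \<le> 1 + t\<^sup>2\<close> bounds
  the norm of \<open>f\<close> by an integrable function.\<close>

lemma L2_01_set_integrable:
  assumes "L2_01 f"
  shows "set_integrable lborel {0..1} f"
proof -
  have m[measurable]: "f \<in> borel_measurable lborel" and "set_integrable lborel {0..1} (\<lambda>x. (norm (f x))\<^sup>2)"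
    using assms by (auto simp: L2_01_def)
  moreover have "set_integrable lborel {0..1} (\<lambda>x::real. 1 :: real)"
    by (intro borel_integrable_atLeastAtMost' continuous_intros)
  ultimately have "set_integrable lborel {0..1} (\<lambda>x. 1 + (norm (f x))\<^sup>2)" by auto
  then show ?thesis
    unfolding set_integrable_def
  proof (rule Bochner_Integration.integrable_bound)
    have "norm (f x) \<le> 1 + (norm (f x))\<^sup>2" for x
      using sum_squares_bound[of 1 "norm (f x)"] norm_ge_zero[of "f x"] by (simp del: norm_ge_zero)
    then show "AE x in lborel. norm (indicator {0..1} x *\<^sub>R f x) \<le> norm (indicator {0..1} x *\<^sub>R (1 + (norm (f x))\<^sup>2))"
      by (intro always_eventually allI) (auto simp: indicator_def abs_of_nonneg intro: order_trans[OF _ abs_ge_self])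
  qed measurable
qed

lemma set_integral_disjoint_support:
  fixes u f :: "real \<Rightarrow> complex"
  assumes "AE x in lborel. x \<in> {a<..<b} \<longrightarrow> u x = 0" and "\<And>x. x \<notin> {a<..<b} \<Longrightarrow> f x = 0"
  shows "(LINT x:A|lborel. u x * f x) = 0"
  unfolding set_lebesgue_integral_def
proof (rule integral_eq_zero_AE)
  show "AE x in lborel. indicator A x *\<^sub>R (u x * f x) = 0"
    using assms(1) by eventually_elim (use assms(2) in force)
qed

lemma fcoef_mult_cis: "fcoef (\<lambda>x. u x * cis (real_of_int k * pi * x)) n = fcoef u (n - k)"
  unfolding fcoef_def
  by (intro arg_cong[where f = "\<lambda>f. set_lebesgue_integral lborel {0..1} f"] ext)
     (simp add: cis_mult mult.assoc algebra_simps)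

lemma parseval_test:
  assumes D: "test_chain N \<alpha> \<beta> D" and "0 \<le> \<alpha>" "\<beta> \<le> 1" and N: "2 \<le> N"
    and w: "set_integrable lborel {0..1} w"
  shows "((\<lambda>n. fcoef (\<lambda>x. complex_of_real (D 0 x)) (- n) * fcoef w n) has_sum
           (LINT x:{0..1}|lborel. w x * complex_of_real (D 0 x))) {n. even n = p}"
proof (rule parseval_smooth[OF w])
  show "continuous_on UNIV (\<lambda>x. complex_of_real (D 0 x))"
    using D by (intro continuous_intros) (auto simp: test_chain_def)
  show "(\<lambda>x. complex_of_real (D 0 x)) differentiable at x" for x
  proof -
    have "(D 0 has_real_derivative D 1 x) (at x)"
      using D N by (auto simp: test_chain_def)
    from has_vector_derivative_of_real[OF this] show ?thesis
      by (rule differentiableI_vector)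
  qed
  show "(\<lambda>n. norm (fcoef (\<lambda>x. complex_of_real (D 0 x)) n)) summable_on UNIV"
    using fcoef_test_summable[OF D assms(2,3), of 0] N by simp
qed

text \<open>Of the \<open>2 * m + 2\<close> derivatives, \<open>2 * m\<close> take over the
  differential operator and two secure summability; the potential part uses \<open>m + 2\<close> of
  them.\<close>

lemma S_pairing_eq_0:
  assumes V: "in_H True (- real m) V"
    and ab: "0 \<le> a" "b \<le> 1"
    and u: "S_dom p m V u" and g: "S_repr p m V u g"
    and zero: "AE x in lborel. x \<in> {a<..<b} \<longrightarrow> u x = 0"
    and D: "test_chain (2 * m + 2) a b D"
  shows "(LINT x:{0..1}|lborel. g x * complex_of_real (D 0 x)) = 0"
proof -
  define P where "P = {n::int. even n = p}"
  define \<psi> where "\<psi> n = fcoef (\<lambda>x. complex_of_real (D 0 x)) (- n)" for n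
  define c where "c = coef p u"
  define I where "I = (LINT x:{0..1}|lborel. g x * complex_of_real (D 0 x))"
  have iu: "set_integrable lborel {0..1} u" and ig: "set_integrable lborel {0..1} g"
    using u g by (auto simp: S_dom_def S_repr_def intro: L2_01_set_integrable)
  have Dzero: "D i x = 0" if "i \<le> 2 * m + 2" "x \<notin> {a<..<b}" for i x
    using D that by (auto simp: test_chain_def not_less)
  have Hg: "((\<lambda>n. \<psi> n * fcoef g n) has_sum I) P"
    unfolding \<psi>_def P_def I_def by (rule parseval_test[OF D ab _ ig]) simp
  have H1: "((\<lambda>n. \<psi> n * (complex_of_real ((real_of_int n * pi) ^ (2 * m)) * c n)) has_sum 0) P"
  proof -
    \<comment> \<open>The differential operator is moved onto the test function;
      \<open>D (2 * m)\<close> keeps the two derivatives that Parseval asks for and still vanishes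
      off the interval.\<close>
    have "test_chain 2 a b (\<lambda>i. D (2 * m + i))"
      using D by (intro test_chain_shift) (simp add: add.commute)
    from parseval_test[OF this ab _ iu, of p]
    have "((\<lambda>n. fcoef (\<lambda>x. complex_of_real (D (2 * m) x)) (- n) * fcoef u n) has_sum
           (LINT x:{0..1}|lborel. u x * complex_of_real (D (2 * m) x))) P"
      by (simp add: P_def)
    moreover have "(LINT x:{0..1}|lborel. u x * complex_of_real (D (2 * m) x)) = 0"
      by (rule set_integral_disjoint_support[OF zero]) (use Dzero in auto)
    ultimately have "((\<lambda>n. fcoef (\<lambda>x. complex_of_real (D (2 * m) x)) (- n) * fcoef u n) has_sum 0) P"
      by simp
    \<comment> \<open>Differentiating \<open>2 * m\<close> times multiplies the coefficient by
      \<open>(-1) ^ m * (n * pi) ^ (2 * m)\<close>; the extra factor \<open>(-1) ^ m\<close> cancels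
      the sign coming from the powers of \<open>\<i>\<close>.\<close>
    from has_sum_cmult_right[OF this, of "(-1) ^ m"]
    have "((\<lambda>n. (-1) ^ m * (fcoef (\<lambda>x. complex_of_real (D (2 * m) x)) (- n) * fcoef u n)) has_sum 0) P"
      unfolding mult_zero_right .
    moreover have "(-1) ^ m * (fcoef (\<lambda>x. complex_of_real (D (2 * m) x)) (- n) * fcoef u n)
        = \<psi> n * (complex_of_real ((real_of_int n * pi) ^ (2 * m)) * c n)" if "n \<in> P" for n
    proof -
      have "(\<i> * of_int (- n) * of_real pi) ^ (2 * m) = ((\<i> * of_int (- n) * of_real pi)\<^sup>2) ^ m"
        by (simp only: power_mult)
      also have "(\<i> * of_int (- n) * of_real pi)\<^sup>2 = - complex_of_real ((real_of_int n * pi)\<^sup>2)"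
        by (simp add: power_mult_distrib)
      also have "\<dots> ^ m = (-1) ^ m * complex_of_real ((real_of_int n * pi) ^ (2 * m))"
        by (simp only: power_minus[of "complex_of_real ((real_of_int n * pi)\<^sup>2)"]) (simp only: power_mult of_real_power)
      finally have *: "fcoef (\<lambda>x. complex_of_real (D (2 * m) x)) (- n)
          = (-1) ^ m * complex_of_real ((real_of_int n * pi) ^ (2 * m)) * \<psi> n"
        using fcoef_deriv_iterate[OF D _ ab, of "2 * m" "- n"] unfolding \<psi>_def by simp
      have "(-1::complex) ^ m * (-1) ^ m = 1" by (simp flip: power_add power_mult_distrib)
      then show ?thesis using that unfolding * by (simp add: c_def coef_def P_def mult_ac del: of_real_power of_real_mult)
    qed
    ultimately show ?thesis by (simp only: cong: has_sum_cong)
  qed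
  \<comment> \<open>Extension by zero off the parity class lets the double series run over all pairs
    of integers, where the change to diagonals is a bijection.\<close>
  define \<psi>P where "\<psi>P n = (if n \<in> P then \<psi> n else 0)" for n
  define F where "F = (\<lambda>(n, j). \<psi>P n * (V (n - j) * c j))"
  have F: "F summable_on (UNIV \<times> UNIV)"
  proof -
    have "(\<lambda>n. norm (\<psi> n) * japan n ^ m) summable_on UNIV"
    proof -
      have "bij_betw uminus (UNIV :: int set) UNIV"
        by (rule bij_betwI[where g = uminus]) auto
      from summable_on_reindex_bij_betw[OF this, of "\<lambda>n. norm (fcoef (\<lambda>x. complex_of_real (D 0 x)) n) * japan n ^ m"]
      show ?thesis using fcoef_test_summable[OF D ab, of m] by (simp add: \<psi>_def japan_def)
    qed
    then have "(\<lambda>n. norm (\<psi>P n) * japan n ^ m) summable_on UNIV"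
      by (rule summable_on_comparison_test) (use japan_pos in \<open>auto simp: \<psi>P_def less_imp_le\<close>)
    moreover have "(\<lambda>n. japan n powr (2 * - real m) * (norm (V n))\<^sup>2) summable_on UNIV"
      using V by (simp add: in_H_def)
    moreover have "(\<lambda>n. japan n powr (2 * real m) * (norm (c n))\<^sup>2) summable_on UNIV"
      using u by (simp add: S_dom_def in_H_def c_def)
    ultimately have "(\<lambda>(n, j). norm (\<psi>P n * (V (n - j) * c j))) summable_on (UNIV \<times> UNIV)"
      using convolution_abs_summable by blast
    then have "(\<lambda>z. norm (F z)) summable_on (UNIV \<times> UNIV)"
      by (simp add: F_def case_prod_unfold)
    then show ?thesis by (rule Infinite_Sum.abs_summable_summable)
  qed
  have row: "infsum (\<lambda>j. F (n, j)) UNIV = \<psi>P n * mult_V V c n" for n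
    by (simp add: F_def mult_V_def infsum_cmult_right')
  have "infsum F (UNIV \<times> UNIV) = 0"
  proof -
    \<comment> \<open>Summing along the diagonals \<open>n - j = k\<close> first produces the pairing of \<open>u * cis (k * pi * x)\<close>
      with the test function, which vanishes.\<close>
    define \<sigma> :: "int \<times> int \<Rightarrow> int \<times> int" where "\<sigma> = (\<lambda>(k, n). (n, n - k))"
    have \<sigma>: "bij_betw \<sigma> (UNIV \<times> UNIV) (UNIV \<times> UNIV)"
      by (rule bij_betwI[where g = "\<lambda>(n, j). (n - j, n)"]) (auto simp: \<sigma>_def)
    have "infsum F (UNIV \<times> UNIV) = infsum (\<lambda>z. F (\<sigma> z)) (UNIV \<times> UNIV)"
      by (rule infsum_reindex_bij_betw[OF \<sigma>, symmetric])
    also have "\<dots> = infsum (\<lambda>k. infsum (\<lambda>n. F (\<sigma> (k, n))) UNIV) UNIV"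
      using F summable_on_reindex_bij_betw[OF \<sigma>, of F] by (intro infsum_Sigma_banach[symmetric]) simp
    also have "\<dots> = 0"
    proof (rule infsum_0)
      fix k
      show "infsum (\<lambda>n. F (\<sigma> (k, n))) UNIV = 0"
      \<comment> \<open>\<open>V\<close> lives on even modes. For even \<open>k\<close> the indices
        \<open>n\<close> and \<open>n - k\<close> have the same parity, so for \<open>n\<close> in
        \<open>P\<close> the value \<open>c (n - k)\<close> is the genuine coefficient of
        \<open>u\<close> and not the default 0.\<close>
      proof (cases "V k = 0")
        case True
        then show ?thesis by (simp add: F_def \<sigma>_def)
      next
        case False
        then have k: "even k" using V by (auto simp: in_H_def)
        have "set_integrable lborel {0..1} (\<lambda>x. u x * cis (real_of_int k * pi * x))"
          by (rule set_integrable_mult_cis[OF iu])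
        from parseval_test[OF D ab _ this, of p]
        have "((\<lambda>n. \<psi> n * fcoef u (n - k)) has_sum
            (LINT x:{0..1}|lborel. u x * cis (real_of_int k * pi * x) * complex_of_real (D 0 x))) P"
          by (simp add: P_def \<psi>_def fcoef_mult_cis)
        also have "(LINT x:{0..1}|lborel. u x * cis (real_of_int k * pi * x) * complex_of_real (D 0 x)) = 0"
          unfolding mult.assoc by (rule set_integral_disjoint_support[OF zero]) (use Dzero in auto)
        finally have "((\<lambda>n. V k * (\<psi> n * fcoef u (n - k))) has_sum V k * 0) P"
          by (rule has_sum_cmult_right)
        moreover have "((\<lambda>n. V k * (\<psi> n * fcoef u (n - k))) has_sum V k * 0) P
            \<longleftrightarrow> ((\<lambda>n. F (\<sigma> (k, n))) has_sum V k * 0) UNIV"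
          by (rule has_sum_cong_neutral) (use k in \<open>auto simp: F_def \<sigma>_def \<psi>P_def P_def c_def coef_def\<close>)
        ultimately show ?thesis by (simp add: infsumI)
      qed
    qed
    finally show ?thesis .
  qed
  then have "infsum (\<lambda>n. \<psi>P n * mult_V V c n) UNIV = 0"
    using infsum_Sigma_banach[OF F] by (simp add: row)
  \<comment> \<open>A value 0 of \<open>infsum\<close> could also be the default for a family that
    is not summable, so summability is established before passing to \<open>has_sum\<close>.\<close>
  moreover have "(\<lambda>n. \<psi>P n * mult_V V c n) summable_on UNIV"
    using summable_on_Sigma_banach[of "\<lambda>n j. F (n, j)" UNIV "\<lambda>_. UNIV"] F by (simp add: row case_prod_unfold)
  ultimately have "((\<lambda>n. \<psi>P n * mult_V V c n) has_sum 0) UNIV"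
    using has_sum_infsum by fastforce
  moreover have "((\<lambda>n. \<psi>P n * mult_V V c n) has_sum 0) UNIV \<longleftrightarrow> ((\<lambda>n. \<psi> n * mult_V V c n) has_sum 0) P"
    by (rule has_sum_cong_neutral) (auto simp: \<psi>P_def)
  ultimately have H2: "((\<lambda>n. \<psi> n * mult_V V c n) has_sum 0) P" by simp
  have "((\<lambda>n. \<psi> n * (complex_of_real ((real_of_int n * pi) ^ (2 * m)) * c n) + \<psi> n * mult_V V c n) has_sum 0) P"
    using has_sum_add[OF H1 H2] by simp
  moreover have "\<psi> n * (complex_of_real ((real_of_int n * pi) ^ (2 * m)) * c n) + \<psi> n * mult_V V c n = \<psi> n * fcoef g n"
    if "n \<in> P" for n
    using g that by (simp add: S_repr_def S_coef_def P_def c_def distrib_left)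
  ultimately have "((\<lambda>n. \<psi> n * fcoef g n) has_sum 0) P"
    by (simp only: cong: has_sum_cong)
  with Hg have "I = 0" using has_sum_unique by blast
  then show ?thesis by (simp add: I_def)
qed

section \<open>From vanishing pairings to vanishing almost everywhere\<close>

text \<open>A Dynkin argument: open intervals are an intersection-stable generator of the Borel
  sets, and sets over which \<open>f\<close> integrates to 0 are closed under countable disjoint
  unions and, as the total integral is 0, under complements. An integrable function with zero
  integral over every Borel set vanishes almost everywhere.\<close>

lemma AE_zero_of_interval_integrals:
  fixes f :: "real \<Rightarrow> complex"
  assumes f: "integrable lborel f" and z: "integral\<^sup>L lborel f = 0"
    and int: "\<And>c d. (LINT x:{c<..<d}|lborel. f x) = 0"
  shows "AE x in lborel. f x = 0"
proof (rule sigma_finite_measure.density_zero[OF sigma_finite_lborel f])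
  fix A :: "real set" assume "A \<in> sets lborel"
  have borel: "sets lborel = sigma_sets UNIV (range (\<lambda>(a, b). {a<..<b::real}))"
    using arg_cong[OF borel_eq_box[where ?'a = real], of sets] by (simp add: box_real)
  have stable: "Int_stable (range (\<lambda>(a, b). {a<..<b::real}))"
    by (auto simp: Int_stable_def)
  have sub: "range (\<lambda>(a, b). {a<..<b::real}) \<subseteq> Pow UNIV" by simp
  have "A \<in> sigma_sets UNIV (range (\<lambda>(a, b). {a<..<b::real}))"
    using \<open>A \<in> sets lborel\<close> unfolding borel .
  then show "(LINT x:A|lborel. f x) = 0"
  proof (induction rule: sigma_sets_induct_disjoint[OF stable sub, consumes 1,
      case_names basic empty compl union])
    case (basic A)
    then show ?case using int by auto
  next
    case empty
    then show ?case by (simp add: set_lebesgue_integral_def)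
  next
    case (compl A)
    have A: "A \<in> sets lborel" using compl unfolding borel by auto
    have "integral\<^sup>L lborel f = (LINT x:A \<union> (UNIV - A)|lborel. f x)"
      by (simp add: set_lebesgue_integral_def)
    also have "\<dots> = (LINT x:A|lborel. f x) + (LINT x:UNIV - A|lborel. f x)"
      by (rule set_integral_Un) (use A f in \<open>auto simp: set_integrable_def intro!: integrable_mult_indicator\<close>)
    finally show ?case using z compl by simp
  next
    case (union A)
    have A: "A i \<in> sets lborel" for i using union unfolding borel by auto
    have "(LINT x:(\<Union>i. A i)|lborel. f x) = (\<Sum>i. (LINT x:A i|lborel. f x))"
      by (rule lebesgue_integral_countable_add)
         (use A f union in \<open>auto simp: set_integrable_def disjoint_family_on_def intro!: integrable_mult_indicator\<close>)
    then show ?case using union by simp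
  qed
qed

theorem theorem3:
  fixes m :: nat and V :: "int \<Rightarrow> complex" and p :: bool
    and u g :: "real \<Rightarrow> complex" and a b :: real
  assumes "m \<ge> 1"
    and "in_H True (- real m) V"
    and "0 \<le> a" and "b \<le> 1"
    and "S_dom p m V u"
    and "S_repr p m V u g"
    and "AE x in lborel. x \<in> {a<..<b} \<longrightarrow> u x = 0"
  shows "AE x in lborel. x \<in> {a<..<b} \<longrightarrow> g x = 0"
proof -
  have gm[measurable]: "g \<in> borel_measurable lborel" and gi: "set_integrable lborel {0..1} g"
    using assms(6) by (auto simp: S_repr_def L2_01_def intro: L2_01_set_integrable)
  define N where "N = 2 * m + 2"
  have zero: "(LINT x:{c<..<d}|lborel. g x) = 0" if cd: "a \<le> c" "d \<le> b" for c d
  proof -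
    define \<epsilon> where "\<epsilon> i = 1 / real (Suc i)" for i
    have \<epsilon>: "\<epsilon> i > 0" for i by (simp add: \<epsilon>_def)
    \<comment> \<open>The construction starts at \<open>c + real N * \<epsilon> i\<close>, so that
      after \<open>N\<close> averagings the left end of the support has moved back exactly to
      \<open>c\<close>.\<close>
    have "\<exists>D. test_chain N c d D \<and> (\<forall>x. 0 \<le> D 0 x \<and> D 0 x \<le> 1) \<and>
       (\<forall>x. c + real N * \<epsilon> i + \<epsilon> i \<le> x \<and> x \<le> d - (real N + 1) * \<epsilon> i \<longrightarrow> D 0 x = 1)" for i
      using exists_test_chain[OF \<epsilon>[of i], of N "c + real N * \<epsilon> i" d] by simp
    then obtain D where D: "\<And>i. test_chain N c d (D i)" "\<And>i x. 0 \<le> D i 0 x \<and> D i 0 x \<le> 1"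
      "\<And>i x. c + real N * \<epsilon> i + \<epsilon> i \<le> x \<Longrightarrow> x \<le> d - (real N + 1) * \<epsilon> i \<Longrightarrow> D i 0 x = 1"
      by metis
    have Dz: "D i j x = 0" if "j \<le> N" "x \<notin> {c<..<d}" for i j x
      using D(1)[of i] that by (auto simp: test_chain_def not_less)
    have "test_chain (2 * m + 2) a b (D i)" for i
      using D(1)[of i] cd by (auto simp: test_chain_def N_def)
    from S_pairing_eq_0[OF assms(2-7) this]
    have pair: "(LINT x:{0..1}|lborel. g x * complex_of_real (D i 0 x)) = 0" for i .
    \<comment> \<open>Dominated convergence, with majorant the norm of \<open>g\<close> on the unit
      interval, carries the vanishing pairings over to the indicator of the interval.\<close>
    have "(\<lambda>i. integral\<^sup>L lborel (\<lambda>x. indicator {0..1} x *\<^sub>R (g x * complex_of_real (D i 0 x))))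
        \<longlonglongrightarrow> integral\<^sup>L lborel (\<lambda>x. indicator {c<..<d} x *\<^sub>R g x)"
    proof (rule integral_dominated_convergence)
      show "integrable lborel (\<lambda>x. indicator {0..1} x *\<^sub>R norm (g x))"
        using set_integrable_norm[OF gi] by (simp add: set_integrable_def)
      show "(\<lambda>x. indicator {0..1} x *\<^sub>R (g x * complex_of_real (D i 0 x))) \<in> borel_measurable lborel" for i
      proof -
        have "continuous_on UNIV (D i 0)" using D(1)[of i] by (auto simp: test_chain_def)
        then have [measurable]: "D i 0 \<in> borel_measurable lborel"
          by (simp add: borel_measurable_continuous_onI)
        show ?thesis by measurable
      qed
      show "AE x in lborel. norm (indicator {0..1} x *\<^sub>R (g x * complex_of_real (D i 0 x)))
          \<le> indicator {0..1} x *\<^sub>R norm (g x)" for i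
        using D(2)[of i] by (auto simp: norm_mult mult_left_le indicator_def)
      show "AE x in lborel. (\<lambda>i. indicator {0..1} x *\<^sub>R (g x * complex_of_real (D i 0 x)))
          \<longlonglongrightarrow> indicator {c<..<d} x *\<^sub>R g x"
      \<comment> \<open>At each point the sequence is eventually constant: outside the interval it
        is 0 throughout, and an inner point lies in the plateau once \<open>\<epsilon> i\<close> is
        small.\<close>
      proof (intro AE_I2 tendsto_eventually)
        fix x
        show "\<forall>\<^sub>F i in sequentially. indicator {0..1} x *\<^sub>R (g x * complex_of_real (D i 0 x)) = indicator {c<..<d} x *\<^sub>R g x"
        proof (cases "x \<in> {c<..<d}")
          case False
          then show ?thesis using Dz by simp
        next
          case True
          have "(\<lambda>i. c + real N * \<epsilon> i + \<epsilon> i) \<longlonglongrightarrow> c + real N * 0 + 0"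
            unfolding \<epsilon>_def by (intro tendsto_intros LIMSEQ_Suc[OF lim_1_over_n])
          then have "\<forall>\<^sub>F i in sequentially. c + real N * \<epsilon> i + \<epsilon> i < x"
            by (rule order_tendstoD) (use True in auto)
          moreover have "(\<lambda>i. d - (real N + 1) * \<epsilon> i) \<longlonglongrightarrow> d - (real N + 1) * 0"
            unfolding \<epsilon>_def by (intro tendsto_intros LIMSEQ_Suc[OF lim_1_over_n])
          then have "\<forall>\<^sub>F i in sequentially. x < d - (real N + 1) * \<epsilon> i"
            by (rule order_tendstoD) (use True in auto)
          ultimately show ?thesis
          proof eventually_elim
            case (elim i)
            then have "D i 0 x = 1" by (intro D(3)) auto
            then show ?case using True cd assms(3,4) by simp
          qed
        qed
      qed
    qed auto
    then have "(\<lambda>i::nat. 0) \<longlonglongrightarrow> (LINT x:{c<..<d}|lborel. g x)"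
      using pair by (simp add: set_lebesgue_integral_def)
    then show ?thesis using LIMSEQ_unique tendsto_const by metis
  qed
  \<comment> \<open>Cutting \<open>g\<close> off to the interval from \<open>a\<close> to
    \<open>b\<close> reduces its integral over any interval to one over an intersection, again an
    open interval, possibly empty, to which \<open>zero\<close> applies.\<close>
  have "AE x in lborel. indicator {a<..<b} x *\<^sub>R g x = 0"
  proof (rule AE_zero_of_interval_integrals)
    have "set_integrable lborel {a<..<b} g"
      by (rule set_integrable_subset[OF gi]) (use assms(3,4) in auto)
    then show "integrable lborel (\<lambda>x. indicator {a<..<b} x *\<^sub>R g x)" by (simp add: set_integrable_def)
    show "integral\<^sup>L lborel (\<lambda>x. indicator {a<..<b} x *\<^sub>R g x) = 0"
      using zero[of a b] by (simp add: set_lebesgue_integral_def)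
    fix c d
    have "indicator {c<..<d} x *\<^sub>R (indicator {a<..<b} x *\<^sub>R g x) = indicator {max a c<..<min b d} x *\<^sub>R g x" for x
      by (auto simp: indicator_def)
    then show "(LINT x:{c<..<d}|lborel. indicator {a<..<b} x *\<^sub>R g x) = 0"
      using zero[of "max a c" "min b d"] by (simp only: set_lebesgue_integral_def)
  qed
  then show ?thesis by eventually_elim (auto simp: indicator_def)
qed

end
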